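(* Let $n\ge 0$, let $x_0,x_1,\ldots,x_n$ be distinct complex numbers, and let $f(x_0),\ldots,f(x_n)\in\mathbb{C}$ be given finite values. Let $\varphi_i[x_0,\ldots,x_i]$ be the inverse differences and $C_i(x)$ the convergents of the associated Thiele continued fraction (both as defined in the context), taken with respect to the order $x_0,x_1,\ldots,x_n$. Suppose the points are ordered in such a way that in each step $$C_j(x_{j+1})\neq f(x_{j+1})\qquad\text{for all } 0\le j<n .$$ Then every two consecutive convergents are different, i.e. $C_j(x)\not\equiv C_{j+1}(x)$ as rational functions for all $0\le j<n$, and $\varphi_i[x_0,\ldots,x_i]\neq\infty$ for all $0\le i\le n$.
   Context: Inverse differences. These are elements of $\mathbb{C}\cup\{\infty\}$ defined recursively by $$\varphi_0[x_k]=f(x_k)\quad (0\le k\le n),$$ $$\varphi_{i+1}[x_0,\ldots,x_i,x_k]=\frac{x_k-x_i}{\varphi_i[x_0,\ldots,x_{i-1},x_k]-\varphi_i[x_0,\ldots,x_i]}\quad (i<k\le n).$$ Intermediate infinite values are allowed in the recursion, with the arithmetic conventions $\infty-c=\infty$ for $c\in\mathbb{C}$, $a/0=\infty$ and $a/\infty=0$ for $a\in\mathbb{C}\setminus\{0\}$. The recursion step from level $i$ to level $i+1$ is carried out when $\varphi_i[x_0,\ldots,x_i]$ is finite. The theorem concerns only the inverse differences $\varphi_i[x_0,\ldots,x_i]$ that appear as coefficients in the continued fraction; intermediate values $\varphi_i[x_0,\ldots,x_{i-1},x_k]$ with $k>i$ may be infinite. Thiele continued fraction and convergents. The Thiele continued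 fraction is $$C_n(x)=\varphi_0[x_0]+\cfrac{x-x_0}{\varphi_1[x_0,x_1]+\cfrac{x-x_1}{\varphi_2[x_0,x_1,x_2]+\cdots+\cfrac{x-x_{n-1}}{\varphi_n[x_0,\ldots,x_n]}}}$$ and its $i$-th convergent $C_i(x)$ is the continued fraction truncated after $\varphi_i[x_0,\ldots,x_i]$; it depends only on the first $i+1$ points. Precisely, once $\varphi_0[x_0],\ldots,\varphi_i[x_0,\ldots,x_i]$ are finite, $C_i(x)=A_i(x)/B_i(x)$, where the polynomials $A_i,B_i$ are given by $A_{-1}=1$, $B_{-1}=0$, $A_0=\varphi_0[x_0]=f(x_0)$, $B_0=1$ and, for $i\ge1$, $$A_i(x)=\varphi_i[x_0,\ldots,x_i]\,A_{i-1}(x)+(x-x_{i-1})A_{i-2}(x),$$ $$B_i(x)=\varphi_i[x_0,\ldots,x_i]\,B_{i-1}(x)+(x-x_{i-1})B_{i-2}(x).$$ The value $C_j(x_{j+1})=A_j(x_{j+1})/B_j(x_{j+1})$ is taken in $\mathbb{C}\cup\{\infty\}$, being $\infty$ (hence different from the finite value $f(x_{j+1})$) if $B_j(x_{j+1})=0$ and $A_j(x_{j+1})\ne0$. The ordering is stepwise: having chosen $x_0,\ldots,x_j$ and formed $C_j$ from them, one chooses $x_{j+1}$ among the remaining points with $C_j(x_{j+1})\neq f(x_{j+1})$. The condition at step $j$ does not presuppose finiteness of the coefficients as a hypothesis: it is imposed on $C_j$ whenever $\varphi_0[x_0],\ldots,\varphi_j[x_0,\ldots,x_j]$ are all finite,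 so that $C_j$ can be formed. *)

theory Defs
  imports Complex_Main "HOL-Computational_Algebra.Polynomial" "HOL-Computational_Algebra.Fraction_Field"
begin

text \<open>The set of complex numbers together with one point at infinity.\<close>

datatype ecomplex = Fin (fin: complex) | Infty

fun ec_minus :: "ecomplex \<Rightarrow> complex \<Rightarrow> ecomplex" where
  "ec_minus (Fin a) c = Fin (a - c)"
| "ec_minus Infty c = Infty"

text \<open>The quotient is meant for arguments that are not of the form 0/0. The lemma
  \<open>num_den_not_both_0\<close> below and the distinctness of the nodes exclude that form
  wherever the function is used, so its value \<open>Infty\<close> there is immaterial.\<close>

fun ec_divide :: "complex \<Rightarrow> ecomplex \<Rightarrow> ecomplex" where
  "ec_divide a (Fin b) = (if b = 0 then Infty else Fin (a / b))"
| "ec_divide a Infty = Fin 0"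

text \<open>\<open>inv_diff f x i k\<close> is \<open>\<phi>\<^sub>i[x\<^sub>0, \<dots>, x\<^sub>i\<^sub>-\<^sub>1, x\<^sub>k]\<close> (for \<open>i \<le> k\<close>).
  If \<open>\<phi>\<^sub>i[x\<^sub>0, \<dots>, x\<^sub>i]\<close> is infinite, the recursion stops; all later
  values are then set to \<open>Infty\<close>, so that an inverse difference which is not \<open>Infty\<close>
  is one which the recursion really produces and which is finite.\<close>

fun inv_diff :: "(complex \<Rightarrow> complex) \<Rightarrow> (nat \<Rightarrow> complex) \<Rightarrow> nat \<Rightarrow> nat \<Rightarrow> ecomplex" where
  "inv_diff f x 0 k = Fin (f (x k))"
| "inv_diff f x (Suc i) k =
     (case inv_diff f x i i of
        Fin c \<Rightarrow> ec_divide (x k - x i) (ec_minus (inv_diff f x i k) c)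
      | Infty \<Rightarrow> Infty)"

abbreviation thiele_coeff :: "(complex \<Rightarrow> complex) \<Rightarrow> (nat \<Rightarrow> complex) \<Rightarrow> nat \<Rightarrow> ecomplex" where
  "thiele_coeff f x i \<equiv> inv_diff f x i i"

text \<open>Numerators and denominators of the convergents, with \<open>A\<^sub>-\<^sub>1 = 1\<close> and
  \<open>B\<^sub>-\<^sub>1 = 0\<close> written out in the equations for index 1. They are meaningful for index
  \<open>i\<close> only if \<open>thiele_coeff f x 0\<close>, ..., \<open>thiele_coeff f x i\<close> are finite,
  since \<open>fin Infty\<close> is unspecified.\<close>

fun thiele_num :: "(complex \<Rightarrow> complex) \<Rightarrow> (nat \<Rightarrow> complex) \<Rightarrow> nat \<Rightarrow> complex poly" where
  "thiele_num f x 0 = [:fin (thiele_coeff f x 0):]"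
| "thiele_num f x (Suc 0) =
     smult (fin (thiele_coeff f x (Suc 0))) (thiele_num f x 0) + [:- x 0, 1:] * 1"
| "thiele_num f x (Suc (Suc i)) =
     smult (fin (thiele_coeff f x (Suc (Suc i)))) (thiele_num f x (Suc i))
     + [:- x (Suc i), 1:] * thiele_num f x i"

fun thiele_den :: "(complex \<Rightarrow> complex) \<Rightarrow> (nat \<Rightarrow> complex) \<Rightarrow> nat \<Rightarrow> complex poly" where
  "thiele_den f x 0 = 1"
| "thiele_den f x (Suc 0) =
     smult (fin (thiele_coeff f x (Suc 0))) (thiele_den f x 0) + [:- x 0, 1:] * 0"
| "thiele_den f x (Suc (Suc i)) =
     smult (fin (thiele_coeff f x (Suc (Suc i)))) (thiele_den f x (Suc i))
     + [:- x (Suc i), 1:] * thiele_den f x i"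

text \<open>The convergent as a rational function, i.e. an element of the fraction field of the
  polynomial ring (the denominator is nonzero by \<open>thiele_den_nonzero\<close> below), and its
  value at a point.\<close>

definition thiele_convergent ::
    "(complex \<Rightarrow> complex) \<Rightarrow> (nat \<Rightarrow> complex) \<Rightarrow> nat \<Rightarrow> complex poly fract" where
  "thiele_convergent f x i = Fract (thiele_num f x i) (thiele_den f x i)"

definition thiele_value ::
    "(complex \<Rightarrow> complex) \<Rightarrow> (nat \<Rightarrow> complex) \<Rightarrow> nat \<Rightarrow> complex \<Rightarrow> ecomplex" where
  "thiele_value f x i z = ec_divide (poly (thiele_num f x i) z) (Fin (poly (thiele_den f x i) z))"

lemma thiele_determinant:
  "poly (thiele_num f x (Suc j)) z * poly (thiele_den f x j) z
     - poly (thiele_num f x j) z * poly (thiele_den f x (Suc j)) z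
   = (-1) ^ j * (\<Prod>i\<le>j. z - x i)"
proof (induction j)
  case 0
  then show ?case by (simp add: algebra_simps)
next
  case (Suc j)
  have "poly (thiele_num f x (Suc (Suc j))) z * poly (thiele_den f x (Suc j)) z
     - poly (thiele_num f x (Suc j)) z * poly (thiele_den f x (Suc (Suc j))) z
     = - (z - x (Suc j)) * (poly (thiele_num f x (Suc j)) z * poly (thiele_den f x j) z
     - poly (thiele_num f x j) z * poly (thiele_den f x (Suc j)) z)"
    by (simp add: algebra_simps)
  then show ?case unfolding Suc by (simp add: algebra_simps)
qed

lemma num_den_not_both_0:
  assumes "\<And>i. i < j \<Longrightarrow> z \<noteq> x i"
  shows "poly (thiele_num f x j) z \<noteq> 0 \<or> poly (thiele_den f x j) z \<noteq> 0"
proof (cases j)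
  case (Suc m)
  have "(-1) ^ m * (\<Prod>i\<le>m. z - x i) \<noteq> 0"
    using assms Suc by (auto simp: less_Suc_eq_le)
  then show ?thesis
    using thiele_determinant[of f x m z] Suc by auto
qed simp

lemma thiele_tail:
  assumes "\<And>i. i \<le> m \<Longrightarrow> thiele_coeff f x i \<noteq> Infty" and "\<And>i. i \<le> m \<Longrightarrow> x k \<noteq> x i"
  shows "case inv_diff f x (Suc m) k of
      Infty \<Rightarrow> poly (thiele_num f x m) (x k) = f (x k) * poly (thiele_den f x m) (x k)
    | Fin t \<Rightarrow>
       t * poly (thiele_num f x m) (x k) + (x k - x m) * (if m = 0 then 1 else poly (thiele_num f x (m - 1)) (x k))
       = f (x k) * (t * poly (thiele_den f x m) (x k) + (x k - x m) * (if m = 0 then 0 else poly (thiele_den f x (m - 1)) (x k)))"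
  using assms
proof (induction m)
  case 0
  then show ?case by (simp add: field_simps)
next
  case (Suc m)
  obtain c where c: "thiele_coeff f x (Suc m) = Fin c"
    using Suc.prems(1)[of "Suc m"] by (cases "thiele_coeff f x (Suc m)") auto
  have ne: "x k - x (Suc m) \<noteq> 0" using Suc.prems(2)[of "Suc m"] by simp
  have IH: "case inv_diff f x (Suc m) k of
      Infty \<Rightarrow> poly (thiele_num f x m) (x k) = f (x k) * poly (thiele_den f x m) (x k)
    | Fin t \<Rightarrow>
       t * poly (thiele_num f x m) (x k) + (x k - x m) * (if m = 0 then 1 else poly (thiele_num f x (m - 1)) (x k))
       = f (x k) * (t * poly (thiele_den f x m) (x k) + (x k - x m) * (if m = 0 then 0 else poly (thiele_den f x (m - 1)) (x k)))"
    using Suc by simp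
  have rec: "inv_diff f x (Suc (Suc m)) k = ec_divide (x k - x (Suc m)) (ec_minus (inv_diff f x (Suc m) k) c)"
    by (simp only: inv_diff.simps(2)[of f x "Suc m" k] c ecomplex.case)
  have A: "poly (thiele_num f x (Suc m)) (x k) = c * poly (thiele_num f x m) (x k)
      + (x k - x m) * (if m = 0 then 1 else poly (thiele_num f x (m - 1)) (x k))"
    using c by (cases m) (simp_all del: inv_diff.simps add: algebra_simps)
  have B: "poly (thiele_den f x (Suc m)) (x k) = c * poly (thiele_den f x m) (x k)
      + (x k - x m) * (if m = 0 then 0 else poly (thiele_den f x (m - 1)) (x k))"
    using c by (cases m) (simp_all del: inv_diff.simps add: algebra_simps)
  show ?case
  proof (cases "inv_diff f x (Suc m) k")
    case Infty
    then show ?thesis using IH unfolding rec by (simp del: inv_diff.simps thiele_num.simps thiele_den.simps)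
  next
    case (Fin t)
    have e: "poly (thiele_num f x (Suc m)) (x k) - f (x k) * poly (thiele_den f x (Suc m)) (x k)
      = (c - t) * (poly (thiele_num f x m) (x k) - f (x k) * poly (thiele_den f x m) (x k))"
      using IH Fin unfolding A B by (simp del: inv_diff.simps add: algebra_simps)
    show ?thesis
    proof (cases "t = c")
      case True
      then show ?thesis using e Fin unfolding rec
        by (simp del: inv_diff.simps thiele_num.simps thiele_den.simps)
    next
      case False
      define a a' b b' where "a = poly (thiele_num f x m) (x k)" and "a' = poly (thiele_num f x (Suc m)) (x k)"
        and "b = poly (thiele_den f x m) (x k)" and "b' = poly (thiele_den f x (Suc m)) (x k)"
      have e': "a' - f (x k) * b' = (c - t) * (a - f (x k) * b)"
        using e by (simp only: a_def a'_def b_def b'_def)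
      define d where "d = x k - x (Suc m)"
      have "d / (t - c) * (a' - f (x k) * b') = - d * (a - f (x k) * b)"
        using False unfolding e' by (simp add: field_simps)
      then have "d / (t - c) * a' + d * a = f (x k) * (d / (t - c) * b' + d * b)"
        by (simp only: right_diff_distrib distrib_left) algebra
      then show ?thesis using Fin False unfolding rec a_def a'_def b_def b'_def d_def
        by (simp del: inv_diff.simps thiele_num.simps thiele_den.simps)
    qed
  qed
qed

lemma thiele_den_nonzero:
  assumes "inj_on x {..j}" and "\<And>i. i \<le> j \<Longrightarrow> thiele_coeff f x i \<noteq> Infty"
  shows "thiele_den f x j \<noteq> 0"
proof (cases j)
  case (Suc m)
  have d: "x j \<noteq> x i" if "i < j" for i
    using inj_onD[OF assms(1), of j i] that by auto
  obtain t where t: "thiele_coeff f x j = Fin t"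
    using assms(2)[of j] by (cases "thiele_coeff f x j") auto
  have "poly (thiele_num f x j) (x j) = f (x j) * poly (thiele_den f x j) (x j)"
    using thiele_tail[of m f x j] t assms(2) d unfolding Suc
    by (cases m) (simp_all del: inv_diff.simps add: algebra_simps)
  then show ?thesis
    using num_den_not_both_0[of j "x j" x f] d by auto
qed simp

end

theory Submission imports Defs
begin

text \<open>If the next coefficient is infinite, the tail of the continued fraction at \<open>x\<^sub>j\<^sub>+\<^sub>1\<close>
  vanishes, so \<open>C\<^sub>j\<close> already interpolates there, which the ordering excludes. Consecutive
  convergents differ because their determinant is up to sign \<open>(z - x\<^sub>0) \<cdots> (z - x\<^sub>j)\<close>, which
  is nonzero at \<open>z = x\<^sub>j\<^sub>+\<^sub>1\<close>.\<close>

lemma thiele_value_eq_if_coeff_Infty: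
  assumes "\<And>i. i \<le> j \<Longrightarrow> thiele_coeff f x i \<noteq> Infty"
    and "\<And>i. i \<le> j \<Longrightarrow> x k \<noteq> x i"
    and "inv_diff f x (Suc j) k = Infty"
  shows "thiele_value f x j (x k) = Fin (f (x k))"
proof -
  have eq: "poly (thiele_num f x j) (x k) = f (x k) * poly (thiele_den f x j) (x k)"
    using thiele_tail[of j f x k, OF assms(1,2)] assms(3) by (simp del: inv_diff.simps)
  \<comment> \<open>By \<open>eq\<close> a zero of the denominator would also be a zero of the
    numerator, the excluded form 0/0. So the value is a true quotient and not
    \<open>Infty\<close>.\<close>
  moreover have "poly (thiele_den f x j) (x k) \<noteq> 0"
    using num_den_not_both_0[of j "x k" x f] assms(2) eq by auto
  ultimately show ?thesis
    by (simp add: thiele_value_def)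
qed

lemma thiele_convergent_Suc_neq:
  assumes "inj_on x {..Suc j}" and "\<And>i. i \<le> Suc j \<Longrightarrow> thiele_coeff f x i \<noteq> Infty"
  shows "thiele_convergent f x j \<noteq> thiele_convergent f x (Suc j)"
proof
  assume "thiele_convergent f x j = thiele_convergent f x (Suc j)"
  \<comment> \<open>Equality of two \<open>Fract\<close> terms may be cross-multiplied only when
    both denominators are nonzero.\<close>
  moreover have "thiele_den f x j \<noteq> 0"
    using assms by (intro thiele_den_nonzero) (auto intro: inj_on_subset)
  moreover have "thiele_den f x (Suc j) \<noteq> 0"
    using assms by (intro thiele_den_nonzero)
  ultimately have "thiele_num f x j * thiele_den f x (Suc j) = thiele_num f x (Suc j) * thiele_den f x j"
    unfolding thiele_convergent_def by (metis eq_fract(1))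
  then have "poly (thiele_num f x j) z * poly (thiele_den f x (Suc j)) z
      = poly (thiele_num f x (Suc j)) z * poly (thiele_den f x j) z" for z
    by (metis poly_mult)
  then have "(-1) ^ j * (\<Prod>i\<le>j. x (Suc j) - x i) = 0"
    using thiele_determinant[of f x j "x (Suc j)"] by simp
  moreover have "x (Suc j) \<noteq> x i" if "i \<le> j" for i
    using inj_onD[OF assms(1), of "Suc j" i] that by auto
  ultimately show False
    by auto
qed

theorem theorem2:
  fixes n :: nat and x :: "nat \<Rightarrow> complex" and f :: "complex \<Rightarrow> complex"
  assumes "inj_on x {0..n}"
    and "\<And>j. j < n \<Longrightarrow> (\<forall>i\<le>j. thiele_coeff f x i \<noteq> Infty) \<Longrightarrow>
           thiele_value f x j (x (Suc j)) \<noteq> Fin (f (x (Suc j)))"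
  shows "(\<forall>j<n. thiele_convergent f x j \<noteq> thiele_convergent f x (Suc j)) \<and>
         (\<forall>i\<le>n. thiele_coeff f x i \<noteq> Infty)"
proof -
  have finite: "thiele_coeff f x i \<noteq> Infty" if "i \<le> n" for i
    using that
  \<comment> \<open>Strong induction, because the ordering condition at step \<open>j\<close>
    becomes available only once all coefficients up to index \<open>j\<close> are known to be
    finite.\<close>
  proof (induction i rule: less_induct)
    case (less i)
    show ?case
    proof (cases i)
      case (Suc j)
      have below: "thiele_coeff f x l \<noteq> Infty" if "l \<le> j" for l
        using less Suc that by simp
      have "x (Suc j) \<noteq> x l" if "l \<le> j" for l
        using inj_onD[OF assms(1), of "Suc j" l] less.prems Suc that by auto
      moreover have "thiele_value f x j (x (Suc j)) \<noteq> Fin (f (x (Suc j)))"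
        using assms(2)[of j] below less.prems Suc by (simp del: inv_diff.simps)
      ultimately show ?thesis
        \<comment> \<open>With \<open>k = Suc j\<close> the inverse difference in that lemma is the
          coefficient of index \<open>i\<close> itself.\<close>
        using thiele_value_eq_if_coeff_Infty[of j f x "Suc j"] below Suc by blast
    qed simp
  qed
  moreover have "thiele_convergent f x j \<noteq> thiele_convergent f x (Suc j)" if "j < n" for j
    using that assms(1) by (intro thiele_convergent_Suc_neq finite) (auto intro: inj_on_subset)
  ultimately show ?thesis
    by blast
qed

end
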